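(* Let $a,b$ be integers with $2\le a<b$ and $\gcd(a,b)=1$, let $c=a+b$ and $S=\{a,b,c\}$. Put $$N=a\Big\lfloor\frac{b}{2a}\Big\rfloor+\min(a,\,b\bmod 2a),\qquad Q=\operatorname{lcm}(a,N).$$ Then for every $n\ge0$ the $n$-th $\mathrm P$-position of $S$ (the $n$-th element of $\mathcal W_0(S)$ in increasing order, indexed from $0$) is $$w(n)=n+a\Big\lfloor\frac na\Big\rfloor+b\Big\lfloor\frac nN\Big\rfloor .$$ Both the set $\mathcal W_0(S)$ and the sequence $\mathcal G_S$ are purely periodic, each with least period $$p_{\mathrm{add}}=2Q+b\frac QN=\frac{a(2N+b)}{\gcd(a,N)},$$ and, writing $\alpha_n=w(n)$ for $0\le n<Q$, one has $\mathcal W_0(S)\cap[0,p_{\mathrm{add}})=\{\alpha_n:0\le n<Q\}$. Moreover, writing $\delta=b-a=\eta a+\varepsilon$ with $\eta=\lfloor\delta/a\rfloor$ and $0\le\varepsilon<a$: if $\eta$ is even, then $N=(\tfrac\eta2+1)a$, $Q=N$, $p_{\mathrm{add}}=(\eta+2)a+b$, and $\alpha_n=n+a\lfloor n/a\rfloor$ for $0\le n<Q=N$; if $\eta$ is odd, then $N=m_\eta:=\delta-\tfrac{\eta-1}{2}a$, $Q=a\,m_\eta$ and $p_{\mathrm{add}}=a(2m_\eta+b)$.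
   Context: $\mathbb N=\{0,1,2,\dots\}$. For a finite nonempty set $S$ of positive integers, the subtraction game $S$ has positions $x\in\mathbb N$ and legal moves $x\mapsto x-s$ for $s\in S$, $s\le x$; a player unable to move loses. The nim-value is $\mathcal G_S(x)=\operatorname{mex}\{\mathcal G_S(x-s):s\in S,\ s\le x\}$, where mex is the least non-negative integer not in the set, and $\mathcal W_0(S)=\{x\in\mathbb N:\mathcal G_S(x)=0\}$ is the set of $\mathrm P$-positions. A sequence $f$ on $\mathbb N$ is purely periodic if there is $p\ge1$ with $f(x+p)=f(x)$ for all $x\ge0$, the least such $p$ being its least period; a subset of $\mathbb N$ is treated via its indicator sequence. $[0,p)=\{0,\dots,p-1\}$. *)

theory Defs
  imports Main "HOL-Library.Infinite_Set" "HOL-Library.Indicator_Function"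
begin

definition mex :: "nat set \<Rightarrow> nat" where
  "mex A = (LEAST n. n \<notin> A)"

(* The guard 0 < s only serves termination: it is vacuous for the sets of positive
   integers for which subtraction games are considered. *)
function nim_value :: "nat set \<Rightarrow> nat \<Rightarrow> nat" where
  "nim_value S x = mex ((\<lambda>s. nim_value S (x - s)) ` {s \<in> S. 0 < s \<and> s \<le> x})"
  by pat_completeness auto
termination
  by (relation "measure snd") auto

declare nim_value.simps [simp del]

definition P_positions :: "nat set \<Rightarrow> nat set" where
  "P_positions S = {x. nim_value S x = 0}"

definition is_period :: "(nat \<Rightarrow> 'a) \<Rightarrow> nat \<Rightarrow> bool" where
  "is_period f p \<longleftrightarrow> p \<ge> 1 \<and> (\<forall>x. f (x + p) = f x)"

definition purely_periodic :: "(nat \<Rightarrow> 'a) \<Rightarrow> bool" where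
  "purely_periodic f \<longleftrightarrow> (\<exists>p. is_period f p)"

(* Only meaningful for purely periodic f. *)
definition least_period :: "(nat \<Rightarrow> 'a) \<Rightarrow> nat" where
  "least_period f = (LEAST p. is_period f p)"

end

(* Spread the naturals to the numbers y with y div a even, cut them at the images F q of the
   multiples q * N, and move the q-th block up by b * q. The resulting set P satisfies the
   recursion of P-positions: a block and its translate by a fill an interval up to
   interlocking ends, and the gap of length about b between two blocks is filled by the
   translates by b and a + b of the lower one. By Ferguson's pairing property the positions of
   nim-value 1 are P + a; in the gap above the q-th block the remaining positions
   alternate between 2 and 3 according to the parity of (x - b * q) div a. All these data are
   invariant under the shift by p_add, with no pre-period. *)

theory Submission
  imports Defs
begin

section \<open>Nim-values of subtraction games\<close>

lemma mex_notin: "finite A \<Longrightarrow> mex A \<notin> A"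
  unfolding mex_def by (rule LeastI_ex) (simp add: ex_new_if_finite)

lemma less_mex_imp_in: "k < mex A \<Longrightarrow> k \<in> A"
  unfolding mex_def using not_less_Least by blast

lemma nim_value_option_neq:
  assumes "finite S" "s \<in> S" "0 < s" "s \<le> x"
  shows "nim_value S (x - s) \<noteq> nim_value S x"
proof
  assume eq: "nim_value S (x - s) = nim_value S x"
  have "nim_value S x \<notin> (\<lambda>s. nim_value S (x - s)) ` {s \<in> S. 0 < s \<and> s \<le> x}"
    using assms(1) by (subst nim_value.simps) (intro mex_notin, simp)
  with assms eq show False by (metis (mono_tags, lifting) image_eqI mem_Collect_eq)
qed

lemma nim_value_option_ex:
  assumes "k < nim_value S x"
  shows "\<exists>s\<in>S. 0 < s \<and> s \<le> x \<and> nim_value S (x - s) = k"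
proof -
  have "k \<in> (\<lambda>s. nim_value S (x - s)) ` {s \<in> S. 0 < s \<and> s \<le> x}"
    using assms by (subst (asm) nim_value.simps) (rule less_mex_imp_in)
  thus ?thesis by auto
qed

lemma nim_value_eqI:
  assumes "finite S"
    and "\<And>k. k < n \<Longrightarrow> \<exists>s\<in>S. 0 < s \<and> s \<le> x \<and> nim_value S (x - s) = k"
    and "\<And>s. s \<in> S \<Longrightarrow> 0 < s \<Longrightarrow> s \<le> x \<Longrightarrow> nim_value S (x - s) \<noteq> n"
  shows "nim_value S x = n"
proof (cases "nim_value S x" n rule: linorder_cases)
  case less
  with assms(2) obtain s where "s \<in> S" "0 < s" "s \<le> x" "nim_value S (x - s) = nim_value S x"
    by blast
  with nim_value_option_neq[OF assms(1)] show ?thesis by blast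
next
  case greater
  with nim_value_option_ex assms(3) show ?thesis by blast
qed

text \<open>Every option is smaller than \<open>x\<close>, so by strong induction the recursion has
  at most one solution; the positions of nim-value 0 satisfy it by the mex rule.\<close>

lemma P_positions_eqI:
  assumes "finite S"
    and rec: "\<And>x. x \<in> X \<longleftrightarrow> (\<forall>s\<in>S. 0 < s \<and> s \<le> x \<longrightarrow> x - s \<notin> X)"
  shows "P_positions S = X"
proof -
  have "nim_value S x = 0 \<longleftrightarrow> x \<in> X" for x
  proof (induction x rule: less_induct)
    case (less x)
    have IH: "nim_value S (x - s) = 0 \<longleftrightarrow> x - s \<in> X" if "0 < s" "s \<le> x" for s
      using less[of "x - s"] that by simp
    have "nim_value S x = 0 \<longleftrightarrow> (\<forall>s\<in>S. 0 < s \<and> s \<le> x \<longrightarrow> nim_value S (x - s) \<noteq> 0)"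
      using nim_value_option_neq[OF assms(1), of _ x] nim_value_option_ex[of 0 S x]
      by (metis gr0I)
    also have "\<dots> \<longleftrightarrow> x \<in> X" using IH by (subst rec) blast
    finally show ?case .
  qed
  thus ?thesis by (auto simp: P_positions_def)
qed

text \<open>Ferguson's pairing property. Subtracting \<open>a\<close> and \<open>t\<close> in either
  order leads to \<open>x - a - t\<close>; a bad option of \<open>x - a\<close> or of
  \<open>x\<close> would therefore, by induction, give a position and one of its options the same
  value, 1 or 0.\<close>

lemma nim_value_eq_1_iff:
  assumes fin: "finite S" and "a \<in> S" "0 < a" and min: "\<And>s. s \<in> S \<Longrightarrow> a \<le> s"
  shows "nim_value S x = 1 \<longleftrightarrow> a \<le> x \<and> nim_value S (x - a) = 0"
proof (induction x rule: less_induct)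
  case (less x)
  have IH: "nim_value S (x - s) = 1 \<longleftrightarrow> a \<le> x - s \<and> nim_value S (x - s - a) = 0"
    if "0 < s" "s \<le> x" for s
    using less[of "x - s"] that by simp
  show ?case
  proof
    assume one: "nim_value S x = 1"
    then obtain s where s: "s \<in> S" "0 < s" "s \<le> x"
      using nim_value_option_ex[of 0 S x] by auto
    hence ax: "a \<le> x" using min le_trans by blast
    have "nim_value S (x - a) = 0"
    proof (rule ccontr)
      assume "nim_value S (x - a) \<noteq> 0"
      then obtain t where t: "t \<in> S" "0 < t" "t \<le> x - a" "nim_value S (x - a - t) = 0"
        using nim_value_option_ex[of 0 S "x - a"] by auto
      hence "nim_value S (x - t) = 1"
        using IH[of t] ax by (simp add: add.commute diff_diff_add)
      moreover have "t \<le> x" using t(3) by linarith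
      ultimately show False using nim_value_option_neq[OF fin t(1,2), of x] one by simp
    qed
    with ax show "a \<le> x \<and> nim_value S (x - a) = 0" by simp
  next
    assume R: "a \<le> x \<and> nim_value S (x - a) = 0"
    hence "nim_value S x \<noteq> 0"
      using nim_value_option_neq[OF fin assms(2,3), of x] by simp
    moreover have "\<not> 1 < nim_value S x"
    proof
      assume "1 < nim_value S x"
      then obtain t where t: "t \<in> S" "0 < t" "t \<le> x" "nim_value S (x - t) = 1"
        using nim_value_option_ex by blast
      hence "a \<le> x - t" "nim_value S (x - a - t) = 0"
        using IH[of t] by (simp_all add: add.commute diff_diff_add)
      moreover from this have "t \<le> x - a" using t(3) R by linarith
      ultimately show False
        using nim_value_option_neq[OF fin t(1,2), of "x - a"] R by simp
    qed
    ultimately show "nim_value S x = 1" by simp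
  qed
qed

section \<open>Block sequences\<close>

text \<open>Block \<open>q\<close> consists of the \<open>y\<close> from \<open>F q\<close> up to
  \<open>F (Suc q)\<close>, moved up by \<open>b * q\<close>, so that a gap of length
  \<open>b\<close> separates successive blocks. \<open>inside\<close> keeps two members of a block
  from differing by \<open>b\<close>; \<open>wrap\<close> supplies the option by \<open>a\<close>
  where the translates by \<open>b\<close> and \<open>a + b\<close> leave a hole in the gap.\<close>

locale block_sequence =
  fixes a b :: nat and F :: "nat \<Rightarrow> nat"
  assumes a_pos: "0 < a" and a_less_b: "a < b"
    and F_0: "F 0 = 0"
    and F_Suc_ge: "F q + b \<le> F (Suc q)" "F q + 2 * a \<le> F (Suc q)"
    and F_Suc_le: "F (Suc q) \<le> F q + a + b"
    and inside: "even (y div a) \<Longrightarrow> F q \<le> y \<Longrightarrow> y + b < F (Suc q) \<Longrightarrow> odd ((y + b) div a)"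
    and wrap: "odd (y div a) \<Longrightarrow> F q \<le> y \<Longrightarrow> y < F q + a \<Longrightarrow> F (Suc q) \<le> y + b
      \<Longrightarrow> even ((y + b - a) div a)"
begin

definition P :: "nat set" where
  "P = {y + b * q |q y. F q \<le> y \<and> y < F (Suc q) \<and> even (y div a)}"

lemma P_I: "F q \<le> y \<Longrightarrow> y < F (Suc q) \<Longrightarrow> even (y div a) \<Longrightarrow> y + b * q \<in> P"
  unfolding P_def by blast

lemma P_E:
  assumes "x \<in> P"
  obtains q y where "x = y + b * q" "F q \<le> y" "y < F (Suc q)" "even (y div a)"
  using assms unfolding P_def by blast

lemma div_shift: "(y + a) div a = Suc (y div a)"
  using a_pos by simp

lemma div_unshift: "odd (y div a) \<Longrightarrow> a \<le> y \<and> even ((y - a) div a)"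
  using div_shift[of "y - a"] by (cases "a \<le> y") auto

lemma F_mono: "q \<le> r \<Longrightarrow> F q \<le> F r"
  by (rule lift_Suc_mono_le[of F]) (use F_Suc_ge(1) add_leD1 in blast)

lemma start_mono: "q \<le> r \<Longrightarrow> F q + b * q \<le> F r + b * r"
  using F_mono by (simp add: add_mono)

lemma start_gap: "q < r \<Longrightarrow> F (Suc q) + b * q + b \<le> F r + b * r"
  using start_mono[of "Suc q" r] by simp

text \<open>The block starts \<open>F q + b * q\<close> begin at 0 and are at least
  \<open>q\<close>, so each \<open>x\<close> falls between two successive ones; the upper bound is
  the start of block \<open>Suc q\<close>.\<close>

lemma start_ex:
  obtains q where "F q + b * q \<le> x" "x < F (Suc q) + b * q + b"
proof -
  have lin: "q \<le> F q + b * q" for q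
    using a_less_b by (simp add: trans_le_add2)
  define q where "q = (LEAST q. x < F (Suc q) + b * q + b)"
  have "x < F (Suc x) + b * x + b" using lin[of "Suc x"] by simp
  hence "x < F (Suc q) + b * q + b" unfolding q_def by (rule LeastI)
  moreover have "F q + b * q \<le> x"
  proof (cases q)
    case (Suc r)
    hence "\<not> x < F (Suc r) + b * r + b"
      using not_less_Least[of r "\<lambda>q. x < F (Suc q) + b * q + b"] by (simp add: q_def)
    thus ?thesis using Suc by simp
  qed (simp add: F_0)
  ultimately show ?thesis using that by blast
qed

section \<open>\<open>P\<close> satisfies the recursion of P-positions\<close>

lemma P_disjoint:
  assumes "x \<in> P" "s \<in> {a, b, a + b}"
  shows "x + s \<notin> P"
proof
  assume "x + s \<in> P"
  then obtain r z where z: "x + s = z + b * r" "F r \<le> z" "z < F (Suc r)" "even (z div a)"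
    by (rule P_E)
  from assms(1) obtain q y where y: "x = y + b * q" "F q \<le> y" "y < F (Suc q)" "even (y div a)"
    by (rule P_E)
  have s: "s = a \<or> s = b \<or> s = a + b" using assms(2) by simp
  consider "r < q" | "r = q" | "r = Suc q" | "Suc q < r" by linarith
  thus False
  proof cases
    case 1
    thus False using start_gap[of r q] y z by linarith
  next
    case 2
    hence zs: "z = y + s" using y z by simp
    \<comment> \<open>Within one block, \<open>a\<close> flips the parity of the quotient,
      \<open>inside\<close> excludes \<open>b\<close>, and the block is no longer than
      \<open>a + b\<close>.\<close>
    from s show False
    proof (elim disjE)
      assume "s = a" thus False using zs y z div_shift[of y] by simp
    next
      assume "s = b" thus False using zs y z inside[of y q] 2 by simp
    next
      assume "s = a + b" thus False using zs y(2) z(3) F_Suc_le[of q] 2 by simp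
    qed
  next
    case 3
    hence e: "y + s = z + b" using y z by simp
    \<comment> \<open>\<open>z\<close> lies beyond the end of block \<open>q\<close>, so
      \<open>y < z\<close>, and \<open>y + s = z + b\<close> forces \<open>s > b\<close>.\<close>
    have "s = a + b" using s e y z 3 a_less_b by auto
    hence "z = y + a" using e by simp
    thus False using y z div_shift[of y] by simp
  next
    case 4
    \<comment> \<open>Two gaps and a whole block lie in between, which is more than
      \<open>a + b\<close>.\<close>
    have "F (Suc (Suc q)) + b * Suc q + b \<le> F r + b * r" using start_gap[OF 4] .
    moreover have "F (Suc q) + b \<le> F (Suc (Suc q))" by (rule F_Suc_ge)
    ultimately show False using s y z a_less_b by auto
  qed
qed

text \<open>From a block position with odd quotient, go down by \<open>a\<close>, or by
  \<open>a + b\<close> if that crosses the gap below. In the gap above block \<open>q\<close> write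
  \<open>x = y + b * q + b\<close>: the move is \<open>b\<close> if \<open>y\<close> has even
  quotient and \<open>a + b\<close> if odd, except when \<open>y - a\<close> drops below the block,
  where \<open>wrap\<close> makes \<open>a\<close> work.\<close>

lemma P_cover:
  assumes "x \<notin> P"
  shows "\<exists>s\<in>{a, b, a + b}. s \<le> x \<and> x - s \<in> P"
proof -
  obtain q where q: "F q + b * q \<le> x" "x < F (Suc q) + b * q + b" by (rule start_ex)
  show ?thesis
  proof (cases "x < F (Suc q) + b * q")
    case True
    define y where "y = x - b * q"
    have y: "x = y + b * q" "F q \<le> y" "y < F (Suc q)" using True q unfolding y_def by auto
    hence "odd (y div a)" using assms P_I[of q y] by auto
    hence a: "a \<le> y" "even ((y - a) div a)" using div_unshift by auto
    show ?thesis
    proof (cases "F q \<le> y - a")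
      case True
      hence "(y - a) + b * q \<in> P" using y a by (intro P_I) auto
      thus ?thesis using y a by auto
    next
      case False
      then obtain r where r: "q = Suc r" using F_0 by (cases q) auto
      have "(y - a) + b * r \<in> P" using y a r False F_Suc_ge(2)[of r] by (intro P_I) auto
      moreover have "(y - a) + b * r = x - (a + b)" "a + b \<le> x" using y a r by auto
      ultimately show ?thesis by auto
    qed
  next
    case False
    define y where "y = x - b * q - b"
    have "F q + b \<le> F (Suc q)" by (rule F_Suc_ge)
    hence y: "x = y + b * q + b" "F q \<le> y" "y < F (Suc q)" "F (Suc q) \<le> y + b"
      using False q unfolding y_def by auto
    show ?thesis
    proof (cases "even (y div a)")
      case True
      hence "y + b * q \<in> P" using y by (intro P_I)
      thus ?thesis using y by auto
    next
      case odd: False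
      hence a: "a \<le> y" "even ((y - a) div a)" using div_unshift by auto
      show ?thesis
      proof (cases "F q \<le> y - a")
        case True
        hence "(y - a) + b * q \<in> P" using y a by (intro P_I) auto
        moreover have "(y - a) + b * q = x - (a + b)" "a + b \<le> x" using y a by auto
        ultimately show ?thesis by auto
      next
        case False
        hence "even ((y + b - a) div a)" using odd y wrap[of y q] a by linarith
        hence "(y + b - a) + b * q \<in> P"
          using y a_less_b False a F_Suc_ge(1)[of q] by (intro P_I) linarith+
        moreover have "(y + b - a) + b * q = x - a" "a \<le> x" using y a by auto
        ultimately show ?thesis by auto
      qed
    qed
  qed
qed

lemma P_positions_eq: "P_positions {a, b, a + b} = P"
proof (rule P_positions_eqI)
  fix x
  show "x \<in> P \<longleftrightarrow> (\<forall>s\<in>{a, b, a + b}. 0 < s \<and> s \<le> x \<longrightarrow> x - s \<notin> P)"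
  proof
    assume "x \<in> P"
    thus "\<forall>s\<in>{a, b, a + b}. 0 < s \<and> s \<le> x \<longrightarrow> x - s \<notin> P"
      using P_disjoint by (metis le_add_diff_inverse2)
  next
    assume "\<forall>s\<in>{a, b, a + b}. 0 < s \<and> s \<le> x \<longrightarrow> x - s \<notin> P"
    thus "x \<in> P" using P_cover[of x] a_pos a_less_b by auto
  qed
qed simp

section \<open>Nim-values 1, 2 and 3\<close>

abbreviation G :: "nat \<Rightarrow> nat" where
  "G \<equiv> nim_value {a, b, a + b}"

lemma G_eq_0_iff: "G x = 0 \<longleftrightarrow> x \<in> P"
  using P_positions_eq by (auto simp: P_positions_def)

lemma G_eq_1_iff: "G x = 1 \<longleftrightarrow> a \<le> x \<and> x - a \<in> P"
  using nim_value_eq_1_iff[of "{a, b, a + b}" a x] a_pos a_less_b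
  by (force simp: G_eq_0_iff)

text \<open>A block position at least \<open>a\<close> above the start of its block lies in
  \<open>P\<close> or \<open>P + a\<close>. What is left lies in a gap or in the first
  \<open>a\<close> positions above it, hence the extra \<open>a\<close> in the bound.\<close>

lemma gap_ex:
  assumes "1 < G x"
  obtains q where "F (Suc q) + b * q \<le> x" "x < F (Suc q) + b * q + b + a"
proof -
  have nP: "x \<notin> P" "\<not> (a \<le> x \<and> x - a \<in> P)"
    using assms G_eq_0_iff[of x] G_eq_1_iff[of x] by auto
  have ax: "a \<le> x"
    using P_cover[OF nP(1)] a_less_b by auto
  \<comment> \<open>Locating \<open>x - a\<close> instead of \<open>x\<close> ensures that
    \<open>y - a\<close> below is still in block \<open>q\<close>.\<close>
  obtain q where q: "F q + b * q \<le> x - a" "x - a < F (Suc q) + b * q + b" by (rule start_ex)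
  have "\<not> x < F (Suc q) + b * q"
  proof
    assume *: "x < F (Suc q) + b * q"
    define y where "y = x - b * q"
    have y: "x = y + b * q" "F q + a \<le> y" "y < F (Suc q)" using * q ax unfolding y_def by auto
    hence "odd (y div a)" using nP(1) P_I[of q y] by auto
    hence "even ((y - a) div a)" using div_unshift by auto
    hence "(y - a) + b * q \<in> P" using y by (intro P_I) auto
    thus False using nP(2) y by auto
  qed
  hence "F (Suc q) + b * q \<le> x" by simp
  moreover have "x < F (Suc q) + b * q + b + a" using q ax by simp
  ultimately show ?thesis by (rule that)
qed

text \<open>Every option of a position in a gap is either in \<open>P\<close>, in \<open>P + a\<close>, or in a
  gap with the opposite parity of the index \<open>(x - b * q) div a\<close>.\<close>

lemma G_gap:
  assumes "1 < G x" "F (Suc q) + b * q \<le> x" "x < F (Suc q) + b * q + b + a"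
  shows "G x = 2 + (x - b * q) div a mod 2"
  using assms
proof (induction x arbitrary: q rule: less_induct)
  case (less x)
  note big = less.prems(1) and lo = less.prems(2) and hi = less.prems(3)
  have nP: "x \<notin> P" "\<not> (a \<le> x \<and> x - a \<in> P)"
    using big G_eq_0_iff[of x] G_eq_1_iff[of x] by auto
  \<comment> \<open>Being neither in \<open>P\<close> nor in \<open>P + a\<close>, \<open>x\<close>
    is in \<open>P + b\<close> or in \<open>P + a + b\<close>, so \<open>x - b\<close> has value 0
    or 1.\<close>
  have Gb: "G (x - b) \<le> 1" if "b \<le> x"
  proof (rule ccontr)
    assume *: "\<not> G (x - b) \<le> 1"
    hence "x - b \<notin> P" using G_eq_0_iff[of "x - b"] by auto
    with P_cover[OF nP(1)] nP(2) have "a + b \<le> x" "x - b - a \<in> P"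
      by (auto simp: add.commute)
    hence "G (x - b) = 1" using G_eq_1_iff by simp
    thus False using * by simp
  qed
  have parity: "(x - b * q) div a = Suc ((x - b * q - a) div a)"
    using div_shift[of "x - b * q - a"] F_Suc_ge(2)[of q] lo by simp
  have Ga: "G (x - a) = 2 + (x - b * q - a) div a mod 2" if *: "a \<le> x" "1 < G (x - a)"
  proof -
    obtain r where r: "F (Suc r) + b * r \<le> x - a" "x - a < F (Suc r) + b * r + b + a"
      using gap_ex *(2) by blast
    have "r = q"
    proof (cases r q rule: linorder_cases)
      case less
      then show ?thesis using F_Suc_ge(2)[of q] start_mono[of "Suc r" q] r(2) lo by simp
    next
      case greater
      then show ?thesis
        using F_Suc_ge[of r] start_mono[of "Suc q" r] r(1) hi *(1) by simp
    qed
    thus ?thesis using less.IH[of "x - a" r] * r a_pos by (simp add: add.commute)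
  qed
  have Gc: "G (x - (a + b)) = 2 + (x - b * q - a) div a mod 2"
    if *: "a + b \<le> x" "1 < G (x - (a + b))"
  proof -
    obtain r where r: "F (Suc r) + b * r \<le> x - (a + b)" "x - (a + b) < F (Suc r) + b * r + b + a"
      using gap_ex *(2) by blast
    \<comment> \<open>A move by \<open>a + b\<close> to a value above 1 goes down exactly one gap;
      passing from \<open>b * q\<close> to \<open>b * r\<close> absorbs the \<open>b\<close>, so the
      index again drops by one.\<close>
    have "Suc r = q"
    proof (cases "Suc r" q rule: linorder_cases)
      case less
      then show ?thesis
        using F_Suc_ge(2)[of q] F_Suc_ge(2)[of "Suc r"] start_mono[of "Suc (Suc r)" q] r(2) lo *(1)
        by simp
    next
      case greater
      then have "F (Suc q) + b * q \<le> F (Suc r) + b * r"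
        by (simp add: F_mono add_mono)
      then show ?thesis using r(1) hi *(1) by simp
    qed
    moreover have "G (x - (a + b)) = 2 + (x - (a + b) - b * r) div a mod 2"
      using less.IH[of "x - (a + b)" r] * r a_pos by simp
    ultimately show ?thesis by (auto simp: algebra_simps)
  qed
  have small: "\<exists>s\<in>{a, b, a + b}. 0 < s \<and> s \<le> x \<and> G (x - s) = k" if "k < 2" for k
    using nim_value_option_ex[of k "{a, b, a + b}" x] big that by auto
  \<comment> \<open>For odd index, \<open>x - a\<close> has to provide the value 2: value 0 would
    put \<open>x\<close> into \<open>P + a\<close>, and value 1 would put \<open>x - a - a\<close>
    into \<open>P\<close> and make the index of \<open>x\<close> even.\<close>
  have start: "1 < G (x - a) \<and> a \<le> x" if odd: "odd ((x - b * q) div a)"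
  proof -
    have ax: "a \<le> x" using P_cover[OF nP(1)] a_less_b by auto
    have "G (x - a) \<noteq> 0" using nP ax G_eq_0_iff by simp
    moreover have "G (x - a) \<noteq> 1"
    proof
      assume "G (x - a) = 1"
      hence "a \<le> x - a" "x - a - a \<in> P" using G_eq_1_iff by auto
      then obtain r y where y: "x = y + b * r + a + a" "F r \<le> y" "y < F (Suc r)" "even (y div a)"
        by (metis P_E add.commute ax le_add_diff_inverse)
      have "r = q"
      proof (cases r q rule: linorder_cases)
        case less
        then show ?thesis using F_Suc_ge(2)[of q] start_mono[of "Suc r" q] y lo by simp
      next
        case greater
        then show ?thesis using start_mono[of "Suc q" r] y hi by simp
      qed
      hence "x - b * q = y + a + a" using y by simp
      hence "(x - b * q) div a = Suc (Suc (y div a))" by (simp add: div_shift)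
      thus False using odd y by simp
    qed
    ultimately show ?thesis using ax by simp
  qed
  show ?case
  proof (rule nim_value_eqI)
    fix k assume k: "k < 2 + (x - b * q) div a mod 2"
    show "\<exists>s\<in>{a, b, a + b}. 0 < s \<and> s \<le> x \<and> G (x - s) = k"
    proof (cases "k < 2")
      case False
      hence "k = 2" "odd ((x - b * q) div a)" using k by (auto simp: odd_iff_mod_2_eq_one)
      hence ax: "a \<le> x" "1 < G (x - a)" using start by auto
      have "even ((x - b * q - a) div a)" using \<open>odd _\<close> parity by simp
      hence "G (x - a) = k" using Ga[OF ax] \<open>k = 2\<close> by (metis add_0_right even_iff_mod_2_eq_zero)
      with ax a_pos show ?thesis by blast
    qed (rule small)
  next
    fix s assume s: "s \<in> {a, b, a + b}" "0 < s" "s \<le> x"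
    show "G (x - s) \<noteq> 2 + (x - b * q) div a mod 2"
    proof (cases "1 < G (x - s)")
      case True
      hence "G (x - s) = 2 + (x - b * q - a) div a mod 2" using s Ga Gb Gc by auto
      thus ?thesis unfolding parity by (simp add: mod_Suc)
    qed auto
  qed simp
qed

section \<open>Invariance under shifts by whole blocks\<close>

lemma P_shift_iff:
  assumes F_shift: "\<And>q. F (q + k) = F q + 2 * a * l"
  shows "x + (2 * a * l + b * k) \<in> P \<longleftrightarrow> x \<in> P"
proof
  have div_eq: "(y + 2 * a * l) div a = y div a + 2 * l" for y
    using a_pos by (simp add: mult.commute mult.left_commute)
  {
    assume "x \<in> P"
    then obtain q y where y: "x = y + b * q" "F q \<le> y" "y < F (Suc q)" "even (y div a)"
      by (rule P_E)
    hence "(y + 2 * a * l) + b * (q + k) \<in> P"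
      using F_shift[of q] F_shift[of "Suc q"] div_eq[of y] by (intro P_I) auto
    thus "x + (2 * a * l + b * k) \<in> P" using y by (simp add: algebra_simps)
  }
  assume "x + (2 * a * l + b * k) \<in> P"
  then obtain r z where z: "x + (2 * a * l + b * k) = z + b * r"
      "F r \<le> z" "z < F (Suc r)" "even (z div a)"
    by (rule P_E)
  \<comment> \<open>The shift is the start of block \<open>k\<close>, so the shifted position lies
    in a block of index at least \<open>k\<close> and can be moved back.\<close>
  have "F k = 2 * a * l" using F_shift[of 0] F_0 by simp
  hence "k \<le> r" using start_gap[of r k] z by (cases "r < k") auto
  then obtain q where q: "r = q + k" using le_Suc_ex by (metis add.commute)
  define y where "y = z - 2 * a * l"
  have y: "z = y + 2 * a * l" "F q \<le> y" "y < F (Suc q)"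
    using F_shift[of q] F_shift[of "Suc q"] z q unfolding y_def by auto
  hence "y + b * q \<in> P" using z div_eq[of y] by (intro P_I) auto
  moreover have "x = y + b * q" using y q z by (simp add: algebra_simps)
  ultimately show "x \<in> P" by simp
qed

text \<open>Values 0 and 1 are read off from \<open>P\<close> and \<open>P + a\<close>. The others
  depend on the parity of the index in a gap, and the shift raises the index by \<open>2 * l\<close>
  while the gap number rises by \<open>k\<close>.\<close>

lemma G_shift:
  assumes F_shift: "\<And>q. F (q + k) = F q + 2 * a * l"
  shows "G (x + (2 * a * l + b * k)) = G x"
proof -
  let ?p = "2 * a * l + b * k"
  note P_iff = P_shift_iff[OF assms]
  consider "G x = 0" | "G x = 1" | "1 < G x" by linarith
  thus ?thesis
  proof cases
    case 1
    thus ?thesis using P_iff[of x] G_eq_0_iff[of x] G_eq_0_iff[of "x + ?p"] by simp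
  next
    case 2
    hence "a \<le> x + ?p" "x + ?p - a \<in> P" using P_iff[of "x - a"] G_eq_1_iff[of x] by auto
    thus ?thesis using 2 G_eq_1_iff[of "x + ?p"] by simp
  next
    case 3
    hence nP: "x \<notin> P" "\<not> (a \<le> x \<and> x - a \<in> P)"
      using G_eq_0_iff[of x] G_eq_1_iff[of x] by auto
    have ax: "a \<le> x" using P_cover[OF nP(1)] a_less_b by auto
    have "x + ?p \<notin> P" "x + ?p - a \<notin> P"
      using P_iff[of x] P_iff[of "x - a"] nP ax by auto
    hence big: "1 < G (x + ?p)"
      using G_eq_0_iff[of "x + ?p"] G_eq_1_iff[of "x + ?p"] by linarith
    obtain q where q: "F (Suc q) + b * q \<le> x" "x < F (Suc q) + b * q + b + a"
      using gap_ex 3 by blast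
    have "x + ?p - b * (q + k) = x - b * q + 2 * l * a"
      using q F_Suc_ge[of q] by (simp add: algebra_simps)
    hence "(x + ?p - b * (q + k)) div a mod 2 = (x - b * q) div a mod 2"
      using a_pos by simp
    moreover have "G (x + ?p) = 2 + (x + ?p - b * (q + k)) div a mod 2"
      using q F_shift[of "Suc q"] by (intro G_gap big) (auto simp: algebra_simps)
    ultimately show ?thesis using G_gap[OF 3 q] by simp
  qed
qed

end

section \<open>The spreading map\<close>

text \<open>For positive \<open>a\<close> this enumerates in increasing order the \<open>y\<close>
  with \<open>y div a\<close> even.\<close>

definition spread :: "nat \<Rightarrow> nat \<Rightarrow> nat" where
  "spread a n = n + a * (n div a)"

lemma spread_strict_mono: "strict_mono (spread a)"
  unfolding spread_def by (auto intro!: strict_monoI add_less_le_mono mult_le_mono div_le_mono)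

lemma spread_eq: "r < a \<Longrightarrow> spread a (a * i + r) = a * (2 * i) + r"
  by (simp add: spread_def)

lemma spread_add: "0 < a \<Longrightarrow> spread a (n + a * l) = spread a n + 2 * a * l"
  by (simp add: spread_def algebra_simps)

lemma even_spread_div: "0 < a \<Longrightarrow> even (spread a n div a)"
  using spread_eq[of "n mod a" a "n div a"] by simp

lemma even_div_imp_spread:
  assumes "0 < a" "even (y div a)"
  obtains n where "y = spread a n"
proof -
  obtain i where i: "y div a = 2 * i" using assms(2) by blast
  have "spread a (a * i + y mod a) = a * (y div a) + y mod a"
    using assms(1) i by (subst spread_eq) auto
  hence "y = spread a (a * i + y mod a)" by simp
  thus ?thesis by (rule that)
qed

text \<open>The two cases decide the minimum in \<open>N\<close>. For \<open>a \<le> b\<close> their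
  names refer to the parity of \<open>(b - a) div a\<close>, which is opposite to that of
  \<open>b div a\<close>.\<close>

lemma block_length_cases:
  fixes a b N :: nat
  assumes "0 < a"
    and N: "N = a * (b div (2 * a)) + min a (b mod (2 * a))"
  obtains (even) k e where "e < a" "b = a * (2 * k + 1) + e" "N = a * (k + 1)"
    | (odd) k e where "e < a" "b = a * (2 * k) + e" "N = a * k + e"
proof -
  define k where "k = b div (2 * a)"
  define t where "t = b mod (2 * a)"
  have t: "t < 2 * a" "b = a * (2 * k) + t"
    using assms(1) mult_div_mod_eq[of "2 * a" b, symmetric] unfolding k_def t_def
    by (simp_all only: mult_ac, simp)
  show ?thesis
  proof (cases "t < a")
    case True
    hence "N = a * k + t" using N unfolding k_def[symmetric] t_def[symmetric] by simp
    with odd True t(2) show ?thesis by blast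
  next
    case False
    hence "N = a * (k + 1)" using N unfolding k_def[symmetric] t_def[symmetric] by simp
    moreover have "t - a < a" "b = a * (2 * k + 1) + (t - a)" using t False by (simp_all add: algebra_simps)
    ultimately show ?thesis using even by blast
  qed
qed

text \<open>In the case \<open>even\<close> the cuts are multiples of \<open>2 * a\<close> and all
  blocks have length \<open>b + a - e\<close>. In the case \<open>odd\<close> the remainder of the
  cut modulo \<open>a\<close> advances by \<open>e\<close>, and a block has length \<open>b\<close>
  or, on a carry, \<open>a + b\<close>.\<close>

lemma block_sequence_spread:
  fixes a b N :: nat
  assumes a: "0 < a" and ab: "a < b"
    and N: "N = a * (b div (2 * a)) + min a (b mod (2 * a))"
  shows "block_sequence a b (\<lambda>q. spread a (q * N))"
  using a N
proof (cases rule: block_length_cases)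
  case (even k e)
  have F: "spread a (q * N) = a * (2 * ((k + 1) * q))" for q
    using spread_eq[OF a, of "(k + 1) * q"] even(3)
    by (metis add_0_right mult.assoc mult.commute)
  show ?thesis
  proof (unfold_locales, unfold F)
    fix q y
    have Suc_q: "a * (2 * ((k + 1) * Suc q)) = a * (2 * ((k + 1) * q)) + a * (2 * k + 1) + a"
      by (simp add: algebra_simps)
    {
      assume "a * (2 * ((k + 1) * q)) \<le> y" "y + b < a * (2 * ((k + 1) * Suc q))"
      then obtain v where "y = a * (2 * ((k + 1) * q)) + v" "v + e < a"
        using Suc_q even by (auto simp: le_iff_add)
      hence y: "y + b = a * (2 * ((k + 1) * q) + 2 * k + 1) + (v + e)" and "v + e < a"
        using even by (simp_all add: algebra_simps)
      hence "(y + b) div a = 2 * ((k + 1) * q) + 2 * k + 1"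
        unfolding y by (intro div_nat_eqI) (simp_all add: algebra_simps)
      thus "odd ((y + b) div a)" by simp
    next
      assume y: "odd (y div a)" "a * (2 * ((k + 1) * q)) \<le> y" "y < a * (2 * ((k + 1) * q)) + a"
      then obtain v where "y = a * (2 * ((k + 1) * q)) + v" "v < a"
        by (auto simp: le_iff_add)
      \<comment> \<open>The first \<open>a\<close> positions of a block have even quotient, so
        \<open>wrap\<close> holds vacuously.\<close>
      hence "y div a = 2 * ((k + 1) * q)" by simp
      with y(1) show "even ((y + b - a) div a)" by simp
    }
  qed (use even a ab in \<open>auto simp: algebra_simps\<close>)
next
  case (odd k e)
  have k: "0 < k" using ab odd by (cases k) auto
  have b2: "2 * a \<le> b" using k odd by (cases k) auto
  show ?thesis
  proof (unfold_locales)
    fix q y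
    define j where "j = q * N div a"
    define r where "r = q * N mod a"
    have r: "r < a" and qN: "q * N = a * j + r" using a by (auto simp: j_def r_def)
    have Fq: "spread a (q * N) = a * (2 * j) + r" using spread_eq[OF r] qN by simp
    have F_Suc: "spread a (Suc q * N) = a * (2 * j) + r + b + (if r + e < a then 0 else a)"
    proof (cases "r + e < a")
      case True
      have "Suc q * N = a * (j + k) + (r + e)" using qN odd by (simp add: algebra_simps)
      thus ?thesis using spread_eq[OF True, of "j + k"] True odd by (simp add: algebra_simps)
    next
      case False
      hence lt: "r + e - a < a" using r odd by simp
      have "Suc q * N = a * (j + k + 1) + (r + e - a)" using qN odd False by (simp add: algebra_simps)
      thus ?thesis using spread_eq[OF lt, of "j + k + 1"] False odd by (simp add: algebra_simps)
    qed
    show "spread a (q * N) + b \<le> spread a (Suc q * N)"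
      "spread a (q * N) + 2 * a \<le> spread a (Suc q * N)"
      "spread a (Suc q * N) \<le> spread a (q * N) + a + b"
      unfolding Fq F_Suc using b2 by auto
    have div2: "(a * (2 * j) + z) div a = 2 * j + z div a" for z using a by simp
    {
      assume y: "even (y div a)" "spread a (q * N) \<le> y" "y + b < spread a (Suc q * N)"
      define z where "z = y - a * (2 * j)"
      \<comment> \<open>A block of length \<open>b\<close> cannot contain both \<open>y\<close> and
        \<open>y + b\<close>, so a carry occurred.\<close>
      have z: "y = a * (2 * j) + z" "r \<le> z" "z < r + a" "a \<le> r + e"
        using y(2,3) unfolding z_def Fq F_Suc by (auto split: if_splits)
      have "z < a"
      proof (rule ccontr)
        assume "\<not> z < a"
        hence "z div a = 1" using z(3) r by (simp add: div_nat_eqI)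
        thus False using y(1) z(1) div2 by simp
      qed
      hence yb: "y + b = a * (2 * (j + k) + 1) + (z + e - a)" and "z + e - a < a"
        using z odd by (simp_all add: algebra_simps)
      hence "(y + b) div a = 2 * (j + k) + 1"
        unfolding yb by (intro div_nat_eqI) (simp_all add: algebra_simps)
      thus "odd ((y + b) div a)" by simp
    next
      assume y: "odd (y div a)" "spread a (q * N) \<le> y" "y < spread a (q * N) + a"
        "spread a (Suc q * N) \<le> y + b"
      define z where "z = y - a * (2 * j)"
      \<comment> \<open>No carry occurred: in a block of length \<open>a + b\<close> the point
        \<open>y + b\<close> would not reach the end.\<close>
      have z: "y = a * (2 * j) + z" "z < r + a" "r + e < a"
        using y(2-4) unfolding z_def Fq F_Suc by (auto split: if_splits)
      have "a \<le> z" using y(1) z(1) div2[of z] by (cases "a \<le> z") auto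
      hence "y + b - a = a * (2 * (j + k)) + (z + e - a)" "z + e - a < a"
        using z odd by (simp_all add: algebra_simps)
      hence "(y + b - a) div a = 2 * (j + k)" by simp
      thus "even ((y + b - a) div a)" by simp
    }
  qed (use a ab in \<open>auto simp: spread_def\<close>)
qed

section \<open>Periods of enumerated sets\<close>

lemma enumerate_range:
  fixes f :: "nat \<Rightarrow> nat"
  assumes "strict_mono f"
  shows "enumerate (range f) n = f n"
proof (induction n)
  case 0
  show ?case unfolding enumerate_0
    using assms by (intro Least_equality) (auto simp: strict_mono_less_eq)
next
  case (Suc n)
  have "infinite (range f)"
    using assms by (simp add: range_inj_infinite strict_mono_imp_inj_on)
  hence "enumerate (range f) (Suc n) = (LEAST s. s \<in> range f \<and> f n < s)"
    using Suc by (simp add: enumerate_Suc'')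
  also have "\<dots> = f (Suc n)"
    using assms by (intro Least_equality) (auto simp: strict_mono_less strict_mono_less_eq)
  finally show ?case .
qed

text \<open>As 0 is in the range, so is the period, which is thus some \<open>w m\<close>. The tail
  of \<open>w\<close> from \<open>m\<close> on and the translate of \<open>w\<close> by
  \<open>p\<close> then have the same range, and a strictly increasing enumeration is
  unique.\<close>

lemma indicator_period_imp_shift:
  fixes w :: "nat \<Rightarrow> nat"
  assumes mono: "strict_mono w" and "w 0 = 0"
    and per: "is_period (indicator (range w) :: nat \<Rightarrow> nat) p"
  obtains m where "0 < m" "p = w m" "\<And>n. w (n + m) = w n + w m"
proof -
  have p: "1 \<le> p" "x + p \<in> range w \<longleftrightarrow> x \<in> range w" for x
    using per unfolding is_period_def indicator_def
    by (simp, metis of_bool_eq_iff)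
  have "0 \<in> range w" using assms(2) by (metis rangeI)
  then obtain m where m: "p = w m" using p(2)[of 0] by auto
  have "0 < m" using m p(1) assms(2) by (cases m) auto
  have "strict_mono (\<lambda>n. w (n + m))" "strict_mono (\<lambda>n. w n + p)"
    using mono by (auto simp: strict_mono_def)
  moreover have "range (\<lambda>n. w (n + m)) = range (\<lambda>n. w n + p)"
  proof (intro equalityI subsetI)
    fix x assume "x \<in> range (\<lambda>n. w (n + m))"
    then obtain n where n: "x = w (n + m)" by blast
    hence "p \<le> x" using mono m by (simp add: strict_mono_less_eq)
    hence "x - p \<in> range w" using p(2)[of "x - p"] n by simp
    then obtain i where "x - p = w i" by blast
    with \<open>p \<le> x\<close> show "x \<in> range (\<lambda>n. w n + p)" by (metis le_add_diff_inverse2 rangeI)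
  next
    fix x assume "x \<in> range (\<lambda>n. w n + p)"
    then obtain n where n: "x = w n + p" by blast
    hence "x \<in> range w" using p(2) by simp
    then obtain i where i: "x = w i" by blast
    hence "w m \<le> w i" using n m by simp
    hence "m \<le> i" using mono by (simp add: strict_mono_less_eq)
    thus "x \<in> range (\<lambda>n. w (n + m))" using i by (metis le_add_diff_inverse2 rangeI)
  qed
  ultimately have "w (n + m) = w n + p" for n
    using enumerate_range[of "\<lambda>n. w (n + m)" n] enumerate_range[of "\<lambda>n. w n + p" n] by simp
  with that m \<open>0 < m\<close> show ?thesis by blast
qed

lemma least_periodI:
  assumes "is_period f p" "\<And>q. is_period f q \<Longrightarrow> p \<le> q"
  shows "purely_periodic f" "least_period f = p"
  using assms unfolding purely_periodic_def least_period_def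
  by (auto intro: Least_equality)

section \<open>The additive game\<close>

locale additive_game =
  fixes a b N :: nat
  assumes a: "0 < a" and ab: "a < b"
    and N: "N = a * (b div (2 * a)) + min a (b mod (2 * a))"
begin

sublocale block_sequence a b "\<lambda>q. spread a (q * N)"
  using a ab N by (rule block_sequence_spread)

definition pos :: "nat \<Rightarrow> nat" where
  "pos n = n + a * (n div a) + b * (n div N)"

lemma N_pos: "0 < N"
  using a N by (cases rule: block_length_cases) (use ab in \<open>auto intro: gr0I\<close>)

lemma pos_spread: "pos n = spread a n + b * (n div N)"
  by (simp add: pos_def spread_def)

lemma pos_0: "pos 0 = 0"
  by (simp add: pos_def)

lemma pos_strict_mono: "strict_mono pos"
  unfolding pos_def by (auto intro!: strict_monoI add_less_le_mono mult_le_mono div_le_mono)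

text \<open>\<open>spread a\<close> maps the indices from \<open>q * N\<close> up to
  \<open>Suc q * N\<close> onto the members of block \<open>q\<close> before its move by
  \<open>b * q\<close>, and \<open>n div N\<close> recovers \<open>q\<close>.\<close>

lemma range_pos: "range pos = P"
proof (intro equalityI subsetI)
  fix x assume "x \<in> range pos"
  then obtain n where n: "x = spread a n + b * (n div N)" using pos_spread by auto
  have "n div N * N \<le> n" "n < Suc (n div N) * N"
    using N_pos dividend_less_div_times[of N n] by simp_all
  thus "x \<in> P" unfolding n
    using even_spread_div[OF a] spread_strict_mono
    by (intro P_I) (auto simp: strict_mono_less strict_mono_less_eq)
next
  fix x assume "x \<in> P"
  then obtain q y where y: "x = y + b * q" "spread a (q * N) \<le> y" "y < spread a (Suc q * N)"
    "even (y div a)"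
    by (rule P_E)
  then obtain n where n: "y = spread a n" using even_div_imp_spread a by blast
  hence "q * N \<le> n" "n < Suc q * N"
    using y spread_strict_mono[of a] strict_mono_less strict_mono_less_eq by blast+
  hence "n div N = q" by (intro div_nat_eqI) (simp_all add: mult.commute)
  hence "x = pos n" using y n pos_spread by simp
  thus "x \<in> range pos" by blast
qed

lemma pos_Suc:
  "pos (Suc n) = pos n + 1 + (if a dvd Suc n then a else 0) + (if N dvd Suc n then b else 0)"
  by (simp add: pos_def div_Suc dvd_eq_mod_eq_0)

section \<open>The period and its minimality\<close>

definition period :: nat where
  "period = pos (lcm a N)"

lemma period_eq: "period = 2 * lcm a N + b * (lcm a N div N)"
  by (simp add: period_def pos_def)

lemma period_pos: "0 < period"
  using a N_pos by (simp add: period_eq lcm_pos_nat)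

lemma G_is_period: "is_period G period"
proof -
  \<comment> \<open>\<open>k\<close> blocks comprise \<open>lcm a N = a * l\<close> indices, so
    \<open>spread\<close> moves the cuts by exactly \<open>2 * a * l\<close>.\<close>
  define k where "k = lcm a N div N"
  define l where "l = lcm a N div a"
  have kl: "lcm a N = k * N" "lcm a N = a * l" by (simp_all add: k_def l_def)
  have "spread a ((q + k) * N) = spread a (q * N) + 2 * a * l" for q
    using spread_add[OF a, of "q * N" l] kl by (simp add: add_mult_distrib)
  from G_shift[OF this] have "G (x + period) = G x" for x
    using kl(2) by (simp add: period_eq k_def mult.assoc)
  thus ?thesis using period_pos by (auto simp: is_period_def)
qed

text \<open>This yields a period of \<open>P\<close> and also carries lower bounds on the periods of
  \<open>P\<close> over to \<open>G\<close>.\<close>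

lemma is_period_P:
  assumes "is_period G p"
  shows "is_period (indicator P :: nat \<Rightarrow> nat) p"
  using assms by (simp add: is_period_def indicator_def G_eq_0_iff[symmetric])

text \<open>A period shifts the sequence of increments of \<open>pos\<close>, and since \<open>0\<close>, \<open>a\<close>, \<open>b\<close>, \<open>a + b\<close> are
  distinct, each increment reveals whether \<open>a\<close> and whether \<open>N\<close> divides the index.\<close>

lemma period_le:
  assumes "is_period (indicator P :: nat \<Rightarrow> nat) p"
  shows "period \<le> p"
proof -
  obtain m where m: "0 < m" "p = pos m" "\<And>n. pos (n + m) = pos n + pos m"
    using indicator_period_imp_shift[OF pos_strict_mono pos_0, unfolded range_pos, OF assms]
    by blast
  have dvd: "(a dvd Suc n + m \<longleftrightarrow> a dvd Suc n) \<and> (N dvd Suc n + m \<longleftrightarrow> N dvd Suc n)" for n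
  proof -
    have "pos (Suc (n + m)) = pos (Suc n) + pos m" using m(3)[of "Suc n"] by simp
    hence "(if a dvd Suc (n + m) then a else 0) + (if N dvd Suc (n + m) then b else 0)
        = (if a dvd Suc n then a else 0) + (if N dvd Suc n then b else 0)"
      unfolding pos_Suc m(3) by linarith
    thus ?thesis using a ab by (simp split: if_splits)
  qed
  \<comment> \<open>With \<open>n = a - 1\<close> the index \<open>Suc n\<close> is
    \<open>a\<close>, so \<open>a\<close> divides \<open>a + m\<close>; likewise for
    \<open>N\<close>.\<close>
  have "a dvd m" "N dvd m"
    using dvd[of "a - 1"] dvd[of "N - 1"] a N_pos by simp_all
  hence "lcm a N \<le> m" using m(1) by (simp add: dvd_imp_le)
  thus ?thesis unfolding period_def m(2) using pos_strict_mono by (simp add: strict_mono_less_eq)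
qed

lemma least_period_G: "purely_periodic G" "least_period G = period"
  using least_periodI[OF G_is_period period_le[OF is_period_P]] by blast+

lemma least_period_P:
  "purely_periodic (indicator P :: nat \<Rightarrow> nat)"
  "least_period (indicator P :: nat \<Rightarrow> nat) = period"
  using least_periodI[OF is_period_P[OF G_is_period] period_le] by blast+

lemma infinite_P: "infinite P"
  using range_pos pos_strict_mono
  by (metis range_inj_infinite strict_mono_imp_inj_on)

lemma enumerate_P: "enumerate P n = pos n"
  using enumerate_range[OF pos_strict_mono] range_pos by simp

lemma P_below_period: "P \<inter> {0..<period} = pos ` {0..<lcm a N}"
  unfolding period_def range_pos[symmetric] using pos_strict_mono by (auto simp: strict_mono_less)

end

theorem theorem36:
  fixes a b c N Q p_add \<delta> \<eta> \<epsilon> :: nat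
    and S W :: "nat set"
    and w :: "nat \<Rightarrow> nat"
  assumes "2 \<le> a" and "a < b" and "gcd a b = 1"
  defines "c \<equiv> a + b"
  defines "S \<equiv> {a, b, c}"
  defines "W \<equiv> P_positions S"
  defines "N \<equiv> a * (b div (2 * a)) + min a (b mod (2 * a))"
  defines "Q \<equiv> lcm a N"
  defines "w \<equiv> (\<lambda>n. n + a * (n div a) + b * (n div N))"
  defines "p_add \<equiv> 2 * Q + b * (Q div N)"
  defines "\<delta> \<equiv> b - a"
  defines "\<eta> \<equiv> \<delta> div a"
  defines "\<epsilon> \<equiv> \<delta> mod a"
  shows "infinite W \<and> (\<forall>n. enumerate W n = w n)
    \<and> purely_periodic (indicator W :: nat \<Rightarrow> nat)
    \<and> least_period (indicator W :: nat \<Rightarrow> nat) = p_add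
    \<and> purely_periodic (nim_value S) \<and> least_period (nim_value S) = p_add
    \<and> p_add = a * (2 * N + b) div gcd a N
    \<and> W \<inter> {0..<p_add} = w ` {0..<Q}
    \<and> \<delta> = \<eta> * a + \<epsilon> \<and> \<epsilon> < a
    \<and> (even \<eta> \<longrightarrow>
         N = (\<eta> div 2 + 1) * a \<and> Q = N \<and> p_add = (\<eta> + 2) * a + b
         \<and> (\<forall>n<Q. w n = n + a * (n div a)))
    \<and> (odd \<eta> \<longrightarrow>
         (let m = \<delta> - (\<eta> - 1) div 2 * a
          in N = m \<and> Q = a * m \<and> p_add = a * (2 * m + b)))"
proof -
  have a: "0 < a" using assms(1) by simp
  interpret additive_game a b N
    by unfold_locales (use a \<open>a < b\<close> N_def in auto)
  have W: "W = P" and S: "S = {a, b, a + b}"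
    using P_positions_eq by (simp_all add: W_def S_def c_def)
  have w: "w = pos"
    unfolding w_def by (rule ext) (simp add: pos_def)
  have p: "p_add = period" unfolding p_add_def Q_def period_eq ..
  have p_gcd: "p_add = a * (2 * N + b) div gcd a N"
  proof -
    define g where "g = gcd a N"
    obtain k l where kl: "a = g * k" "N = g * l" unfolding g_def by (meson dvdE gcd_dvd1 gcd_dvd2)
    have g: "0 < g" using a by (simp add: g_def)
    have "g * Q = g * (k * N)"
      using prod_gcd_lcm_nat[of a N] kl(1) unfolding Q_def g_def by (metis mult.assoc)
    hence Q: "Q = k * N" using g by simp
    hence "p_add = k * (2 * N + b)" using N_pos by (simp add: p_add_def algebra_simps)
    moreover have "a * (2 * N + b) div g = k * (2 * N + b)"
      unfolding kl(1) mult.assoc using g by simp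
    ultimately show ?thesis by (simp add: g_def)
  qed
  have \<delta>: "\<delta> = \<eta> * a + \<epsilon>" "\<epsilon> < a"
    using a by (simp_all add: \<eta>_def \<epsilon>_def)
  \<comment> \<open>The parity of \<open>\<eta>\<close> decides whether \<open>b mod (2 * a)\<close>
    is \<open>a + \<epsilon>\<close> or \<open>\<epsilon>\<close>, and so which term is the minimum
    in \<open>N\<close>.\<close>
  have b: "b = \<eta> * a + \<epsilon> + a" using \<delta>(1) \<open>a < b\<close> by (simp add: \<delta>_def)
  have even_case: "N = (\<eta> div 2 + 1) * a \<and> Q = N \<and> p_add = (\<eta> + 2) * a + b
         \<and> (\<forall>n<Q. w n = n + a * (n div a))" if "even \<eta>"
  proof -
    from that obtain k where k: "\<eta> = 2 * k" by blast
    have b': "b = 2 * a * k + (a + \<epsilon>)" using b k by (simp add: algebra_simps)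
    have "b div (2 * a) = k" "b mod (2 * a) = a + \<epsilon>"
      unfolding b' using \<delta>(2) by simp_all
    hence N: "N = (\<eta> div 2 + 1) * a" using k by (simp add: N_def algebra_simps)
    hence Q: "Q = N" unfolding Q_def by (simp add: lcm_proj2_if_dvd_nat)
    moreover have "p_add = (\<eta> + 2) * a + b"
      using N_pos N k by (simp add: p_add_def Q algebra_simps)
    ultimately show ?thesis using N by (simp add: w_def)
  qed
  have odd_case: "let m = \<delta> - (\<eta> - 1) div 2 * a
          in N = m \<and> Q = a * m \<and> p_add = a * (2 * m + b)" if "odd \<eta>"
  proof -
    from that obtain k where k: "\<eta> = 2 * k + 1" by (rule oddE)
    have b': "b = 2 * a * (k + 1) + \<epsilon>" using b k by (simp add: algebra_simps)
    have "b div (2 * a) = k + 1" "b mod (2 * a) = \<epsilon>"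
      unfolding b' using \<delta>(2) by (simp_all only: div_mult_self4 mod_mult_self4, simp_all)
    hence N: "N = a * (k + 1) + \<epsilon>" using \<delta>(2) by (simp add: N_def)
    hence m: "N = \<delta> - (\<eta> - 1) div 2 * a" using \<delta>(1) k by (simp add: algebra_simps)
    \<comment> \<open>Both \<open>N\<close> and \<open>b\<close> are congruent to
      \<open>\<epsilon>\<close> modulo \<open>a\<close>, so coprimality passes from \<open>b\<close>
      to \<open>N\<close>.\<close>
    have "gcd a N = gcd a \<epsilon>" "gcd a b = gcd a \<epsilon>"
      using gcd_add_mult[of a "k + 1" \<epsilon>] gcd_add_mult[of a "2 * (k + 1)" \<epsilon>]
      unfolding N b' by (simp_all only: mult_ac)
    hence "gcd a N = 1" using assms(3) by simp
    hence "Q = a * N" unfolding Q_def using prod_gcd_lcm_nat[of a N] by simp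
    with p_gcd \<open>gcd a N = 1\<close> show ?thesis unfolding Let_def m[symmetric] by simp
  qed
  show ?thesis
    using infinite_P enumerate_P least_period_P least_period_G P_below_period p_gcd \<delta>
      even_case odd_case
    unfolding W S w p Q_def by blast
qed

end
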